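(* Let $p_1,p_3,p_4$ be distinct primes and $\hat{\mathbf{K}}=(\hat K,\leq_p)$ as in the context. For every infinite cardinal $\lambda$, $\hat{\mathbf{K}}$ is not stable in $\lambda$; that is, there is $M\in\hat K$ of cardinality $\lambda$ with $|\mathbf{gS}(M)|>\lambda$.
   Context: For an abelian group $G$ and prime $p$, $p^\omega G:=\bigcap_{n\geq 0}p^nG$. $H\leq_p G$ means $H$ is a pure subgroup: $nH=H\cap nG$ for all integers $n$. $\hat K_1$ is the class of torsion-free abelian groups $G$ with $G=p_1^\omega G$ and $p^\omega G=0$ for all primes $p\neq p_1$. $\hat K_2$ is the class of torsion-free abelian groups $G$ such that (a) for every $g\in p_1^\omega G$ there is at most one $z\in p_3^\omega G$ with $g+z\in p_4^\omega G$, and (b) for every $g\in p_1^\omega G$ there exist an integer $k>0$ and $z\in p_3^\omega G$ with $kg+z\in p_4^\omega G$. $\hat K=\hat K_1\cup\hat K_2$; $\hat{\mathbf{K}}$ is an AEC admitting intersections, with $\operatorname{cl}^N(A):=\bigcap\{M: A\subseteq M\leq_p N, M\in\hat K\}$. Galois types: $\mathbf{gtp}(b_1/A;N_1)=\mathbf{gtp}(b_2/A;N_2)$ iff there is an isomorphism $f:\operatorname{cl}^{N_1}(\{b_1\}\cup A)\cong\operatorname{cl}^{N_2}(\{b_2\}\cup A)$ fixing $A$ pointwise with $f(b_1)=b_2$. For $M\in\hat K$, $\mathbf{gS}(M)=\{\mathbf{gtp}(a/M;N): M\leq_p N\in\hat K, a\in N\}$. Stability in $\lambda$ means $|\mathbf{gS}(M)|\le\lambda$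 for every $M\in\hat K$ with $|M|=\lambda$. *)

theory Defs
  imports "HOL-Algebra.Group" "HOL-Computational_Algebra.Primes"
begin

unbundle cardinal_syntax

text \<open>
  Abelian groups are the commutative groups of \<open>HOL-Algebra\<close>, hence in multiplicative notation:
  \<open>n g\<close>, \<open>g + z\<close> and \<open>0\<close> become \<open>g [^] n\<close>, \<open>g \<otimes> z\<close> and \<open>\<one>\<close>.
\<close>

definition torsion_free :: "'u monoid \<Rightarrow> bool" where
  "torsion_free G \<longleftrightarrow>
     (\<forall>g\<in>carrier G. \<forall>n::nat. n > 0 \<longrightarrow> g [^]\<^bsub>G\<^esub> n = \<one>\<^bsub>G\<^esub> \<longrightarrow> g = \<one>\<^bsub>G\<^esub>)"

definition multiples :: "int \<Rightarrow> 'u monoid \<Rightarrow> 'u set \<Rightarrow> 'u set" where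
  "multiples n G A = (\<lambda>g. g [^]\<^bsub>G\<^esub> n) ` A"

definition p_omega :: "nat \<Rightarrow> 'u monoid \<Rightarrow> 'u set" where
  "p_omega p G = (\<Inter>n::nat. multiples (int p ^ n) G (carrier G))"

definition pure_subgroup :: "'u set \<Rightarrow> 'u monoid \<Rightarrow> bool" where
  "pure_subgroup H G \<longleftrightarrow> subgroup H G \<and>
     (\<forall>n::int. multiples n G H = H \<inter> multiples n G (carrier G))"

text \<open>
  \<open>M \<le>\<^sub>p N\<close> for groups as structures. The operation of an \<open>HOL-Algebra\<close> record is arbitrary outside
  the carrier, so "substructure" asks for agreement on \<open>carrier M\<close> only.
\<close>

definition pure_le :: "'u monoid \<Rightarrow> 'u monoid \<Rightarrow> bool" where
  "pure_le M N \<longleftrightarrow> pure_subgroup (carrier M) N \<and> \<one>\<^bsub>M\<^esub> = \<one>\<^bsub>N\<^esub> \<and>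
     (\<forall>x\<in>carrier M. \<forall>y\<in>carrier M. x \<otimes>\<^bsub>M\<^esub> y = x \<otimes>\<^bsub>N\<^esub> y)"

definition K1_hat :: "nat \<Rightarrow> 'u monoid set" where
  "K1_hat p1 = {G. comm_group G \<and> torsion_free G \<and> carrier G = p_omega p1 G \<and>
     (\<forall>p::nat. prime p \<and> p \<noteq> p1 \<longrightarrow> p_omega p G = {\<one>\<^bsub>G\<^esub>})}"

definition K2_hat :: "nat \<Rightarrow> nat \<Rightarrow> nat \<Rightarrow> 'u monoid set" where
  "K2_hat p1 p3 p4 = {G. comm_group G \<and> torsion_free G \<and>
     (\<forall>g\<in>p_omega p1 G. \<forall>z\<in>p_omega p3 G. \<forall>z'\<in>p_omega p3 G.
        g \<otimes>\<^bsub>G\<^esub> z \<in> p_omega p4 G \<and> g \<otimes>\<^bsub>G\<^esub> z' \<in> p_omega p4 G \<longrightarrow> z = z') \<and>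
     (\<forall>g\<in>p_omega p1 G. \<exists>k::int. k > 0 \<and>
        (\<exists>z\<in>p_omega p3 G. g [^]\<^bsub>G\<^esub> k \<otimes>\<^bsub>G\<^esub> z \<in> p_omega p4 G))}"

definition K_hat :: "nat \<Rightarrow> nat \<Rightarrow> nat \<Rightarrow> 'u monoid set" where
  "K_hat p1 p3 p4 = K1_hat p1 \<union> K2_hat p1 p3 p4"

context
  fixes p1 p3 p4 :: nat
begin

definition cl :: "'u monoid \<Rightarrow> 'u set \<Rightarrow> 'u set" where
  "cl N A = \<Inter> {carrier M |M. A \<subseteq> carrier M \<and> pure_le M N \<and> M \<in> K_hat p1 p3 p4}"

definition cl_group :: "'u monoid \<Rightarrow> 'u set \<Rightarrow> 'u monoid" where
  "cl_group N A = N\<lparr>carrier := cl N A\<rparr>"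

text \<open>Equality of the Galois types of \<open>b1\<close> in \<open>N1\<close> and of \<open>b2\<close> in \<open>N2\<close>, both over \<open>A\<close>.\<close>

definition gtp_eq :: "'u set \<Rightarrow> 'u \<times> 'u monoid \<Rightarrow> 'u \<times> 'u monoid \<Rightarrow> bool" where
  "gtp_eq A = (\<lambda>(b1, N1) (b2, N2).
     \<exists>f \<in> iso (cl_group N1 (insert b1 A)) (cl_group N2 (insert b2 A)).
       (\<forall>a\<in>A. f a = a) \<and> f b1 = b2)"

definition gtp :: "'u \<Rightarrow> 'u set \<Rightarrow> 'u monoid \<Rightarrow> ('u \<times> 'u monoid) set" where
  "gtp b A N = {(b', N'). N' \<in> K_hat p1 p3 p4 \<and> A \<subseteq> carrier N' \<and> b' \<in> carrier N' \<and>
     gtp_eq A (b, N) (b', N')}"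

definition gS :: "'u monoid \<Rightarrow> ('u \<times> 'u monoid) set set" where
  "gS M = {gtp a (carrier M) N |a N. pure_le M N \<and> N \<in> K_hat p1 p3 p4 \<and> a \<in> carrier N}"

text \<open>
  The type \<open>'u\<close> is the universe from which the elements of all groups are drawn, and \<open>\<kappa>\<close> is a
  cardinal in the sense of \<open>Card_order\<close>. If \<open>\<kappa>\<close> is smaller than the cardinality of \<open>'u\<close> then, by
  Loewenheim-Skolem, \<open>gS M\<close> has as many elements as the class of all Galois types over \<open>M\<close>. Over
  any \<open>'u\<close> it has at most that many, so instability over \<open>'u\<close> implies instability outright.
\<close>

definition stable_in :: "'u itself \<Rightarrow> 'b rel \<Rightarrow> bool" where
  "stable_in (_ :: 'u itself) \<kappa> \<longleftrightarrow>
     (\<forall>M :: 'u monoid. M \<in> K_hat p1 p3 p4 \<and> |carrier M| =o \<kappa> \<longrightarrow> |gS M| \<le>o \<kappa>)"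

end

end

theory Submission
  imports Defs Complex_Main "HOL-Library.Countable" "HOL-Library.Function_Algebras"
begin

text \<open>
  Let \<open>I\<close> have cardinality \<open>\<kappa>\<close> and let \<open>M\<close> be the direct sum of copies \<open>\<int>[1/p1] e\<^sub>i\<close>, \<open>i \<in> I\<close>, which
  lies in \<open>K1_hat\<close>. For \<open>S \<subseteq> I\<close> put \<open>q\<^sub>i = 1\<close> if \<open>i \<in> S\<close> and \<open>q\<^sub>i = p1\<close> otherwise, and let \<open>N\<^sub>S\<close> be
  the direct sum of the groups \<open>\<int>[1/p1] e\<^sub>i + \<int>[1/p3] z\<^sub>i + \<int>[1/p4] (q\<^sub>i e\<^sub>i + z\<^sub>i)\<close> of rank two.
  The three kinds of summands are exactly the \<open>p1\<close>-, \<open>p3\<close>- and \<open>p4\<close>-divisible parts of \<open>N\<^sub>S\<close>, so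
  \<open>N\<^sub>S\<close> lies in \<open>K2_hat\<close>, \<open>M\<close> is pure in it, and the closure of \<open>M\<close> with a single \<open>z\<^sub>j\<close> is
  all of \<open>N\<^sub>S\<close>: the closure cannot lie in \<open>K1_hat\<close>, so it contains a nonzero multiple of every \<open>z\<^sub>i\<close>.
  An isomorphism over \<open>M\<close> fixes the \<open>e\<^sub>i\<close>, and \<open>S\<close> is recovered as the set of those \<open>i\<close> for which
  \<open>e\<^sub>i + z\<close> is \<open>p4\<close>-divisible for some \<open>p3\<close>-divisible \<open>z\<close>. Hence the \<open>2\<^sup>\<kappa>\<close> types of \<open>z\<^sub>j\<close>
  in the groups \<open>N\<^sub>S\<close> over \<open>M\<close> are pairwise different.
\<close>

subsection \<open>The rings \<open>\<int>[1/m]\<close>\<close>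

text \<open>Membership means that some power of \<open>m\<close> clears the denominator. For
  \<open>m = 0\<close> the exponent \<open>n = 1\<close> admits every rational, so only
  \<open>m > 0\<close> yields the ring \<int>[1/m].\<close>

definition localization :: "nat \<Rightarrow> rat set" where
  "localization m = {x. \<exists>n. x * of_nat m ^ n \<in> \<int>}"

lemma Ints_subset_localization: "x \<in> \<int> \<Longrightarrow> x \<in> localization m"
  unfolding localization_def by (auto intro!: exI[of _ 0])

lemma localization_0 [simp]: "0 \<in> localization m"
  and localization_1 [simp]: "1 \<in> localization m"
  by (simp_all add: Ints_subset_localization)

lemma localization_uminus: "x \<in> localization m \<Longrightarrow> - x \<in> localization m"
  unfolding localization_def by auto

lemma localization_add:
  assumes "x \<in> localization m" "y \<in> localization m"
  shows "x + y \<in> localization m"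
proof -
  from assms obtain k l where k: "x * of_nat m ^ k \<in> \<int>" and l: "y * of_nat m ^ l \<in> \<int>"
    unfolding localization_def by auto
  have "x * of_nat m ^ k * of_nat m ^ l + y * of_nat m ^ l * of_nat m ^ k \<in> \<int>"
    by (intro Ints_add Ints_mult[OF k] Ints_mult[OF l]) auto
  then have "(x + y) * of_nat m ^ (k + l) \<in> \<int>"
    by (simp add: power_add algebra_simps)
  then show ?thesis unfolding localization_def by blast
qed

lemma localization_diff:
  "x \<in> localization m \<Longrightarrow> y \<in> localization m \<Longrightarrow> x - y \<in> localization m"
  using localization_add[OF _ localization_uminus] by fastforce

lemma localization_mult_Ints:
  assumes "x \<in> localization m" "k \<in> \<int>"
  shows "k * x \<in> localization m"
proof -
  from assms obtain n where "x * of_nat m ^ n \<in> \<int>"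
    unfolding localization_def by auto
  then have "k * x * of_nat m ^ n \<in> \<int>"
    using assms(2) by (metis Ints_mult mult.assoc)
  then show ?thesis unfolding localization_def by blast
qed

text \<open>Places elements of \<int>[1/p3] and \<int>[1/p4], say, in one common ring, so that their
  sums can be tested for divisibility by the third prime.\<close>

lemma localization_mult_left: "x \<in> localization m \<Longrightarrow> x \<in> localization (m * k)"
  and localization_mult_right: "x \<in> localization m \<Longrightarrow> x \<in> localization (k * m)"
proof -
  assume "x \<in> localization m"
  then obtain n where n: "x * of_nat m ^ n \<in> \<int>"
    unfolding localization_def by auto
  have "x * of_nat m ^ n * of_nat k ^ n \<in> \<int>"
    by (intro Ints_mult[OF n]) auto
  then have "x * of_nat (m * k) ^ n \<in> \<int>"
    by (simp add: power_mult_distrib mult.assoc)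
  then show "x \<in> localization (m * k)" "x \<in> localization (k * m)"
    unfolding localization_def by (auto simp: mult.commute)
qed

lemma localization_divide_power:
  assumes "x \<in> localization m" "m > 0"
  shows "x / of_nat m ^ n \<in> localization m"
proof -
  from assms obtain k where "x * of_nat m ^ k \<in> \<int>"
    unfolding localization_def by auto
  then have "x / of_nat m ^ n * of_nat m ^ (k + n) \<in> \<int>"
    using assms(2) by (simp add: power_add)
  then show ?thesis unfolding localization_def by blast
qed

text \<open>Bezout for powers: from \<open>a * m ^ i + b * k ^ j = 1\<close> one gets
  \<open>x = a * (x * m ^ i) + b * (x * k ^ j)\<close>, an integral combination of two
  integers.\<close>

lemma localization_Int_coprime:
  assumes "coprime m k" "m > 0" "x \<in> localization m" "x \<in> localization k"
  shows "x \<in> \<int>"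
proof -
  from assms obtain i j where "x * of_nat m ^ i \<in> \<int>" "x * of_nat k ^ j \<in> \<int>"
    unfolding localization_def by auto
  moreover obtain a b where "a * int (m ^ i) + b * int (k ^ j) = 1"
    using assms(1) by (metis bezout_int coprime_imp_gcd_eq_1 coprime_int_iff coprime_power_left_iff coprime_power_right_iff)
  ultimately have "of_int a * (x * of_nat m ^ i) + of_int b * (x * of_nat k ^ j) \<in> \<int>"
    and e: "of_int (a * int (m ^ i) + b * int (k ^ j)) = (1::rat)"
    by (auto intro!: Ints_add Ints_mult)
  moreover have "of_int a * (x * of_nat m ^ i) + of_int b * (x * of_nat k ^ j)
      = x * of_int (a * int (m ^ i) + b * int (k ^ j))"
    by (simp add: algebra_simps)
  ultimately show ?thesis by simp
qed

text \<open>A power of \<open>m\<close> turns \<open>x\<close> into an integer \<open>K\<close> that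
  is still divisible by every power of \<open>p\<close>, since \<open>p\<close> is coprime to
  \<open>m\<close>; only \<open>0\<close> has this property. All computations of divisible parts
  rest on this.\<close>

lemma localization_divisible_eq_0:
  assumes "coprime p m" "p > 1" "m > 0" and div: "\<And>n. x / of_nat p ^ n \<in> localization m"
  shows "x = 0"
proof -
  from div[of 0] obtain N where "x * of_nat m ^ N \<in> \<int>"
    unfolding localization_def by auto
  then obtain K where K: "x * of_nat m ^ N = of_int K"
    by (auto elim: Ints_cases)
  have "int p ^ n dvd K" for n
  proof -
    from div[of n] obtain k where "x / of_nat p ^ n * of_nat m ^ k \<in> \<int>"
      unfolding localization_def by auto
    then obtain L where L: "x / of_nat p ^ n * of_nat m ^ k = of_int L"
      by (auto elim: Ints_cases)
    have "of_int (K * int m ^ k) = x * of_nat m ^ N * of_nat m ^ k"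
      using K by simp
    also have "\<dots> = of_nat p ^ n * of_nat m ^ N * (x / of_nat p ^ n * of_nat m ^ k)"
      using assms(2) by simp
    also have "\<dots> = of_int (int p ^ n * int m ^ N * L)"
      unfolding L by simp
    finally have "K * int m ^ k = int p ^ n * (int m ^ N * L)"
      by (simp only: of_int_eq_iff mult.assoc)
    then have "int p ^ n dvd K * int m ^ k" by simp
    moreover have "coprime (int p ^ n) (int m ^ k)" using assms(1) by simp
    ultimately show ?thesis by (simp add: coprime_dvd_mult_left_iff)
  qed
  \<comment> \<open>The exponent \<bar>K\<bar> is large enough, because \<open>p ^ n > n\<close> for
    every \<open>n\<close>.\<close>
  moreover have "\<not> int p ^ nat (\<bar>K\<bar>) dvd K" if "K \<noteq> 0"
  proof
    assume "int p ^ nat (\<bar>K\<bar>) dvd K"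
    then have "int p ^ nat \<bar>K\<bar> \<le> \<bar>K\<bar>"
      using that by (metis dvd_imp_le_int of_nat_power abs_of_nat)
    moreover have "nat \<bar>K\<bar> < p ^ nat \<bar>K\<bar>"
      using assms(2) by (simp add: power_gt_expt)
    ultimately show False by (metis nat_int nat_mono not_le of_nat_power)
  qed
  ultimately have "K = 0" by blast
  with K assms(3) show ?thesis by simp
qed

subsection \<open>Finitely supported functions\<close>

lemma card_of_lists_length_ordLeq:
  assumes "infinite A"
  shows "|{xs. set xs \<subseteq> A \<and> length xs = n}| \<le>o |A|"
proof (induction n)
  case 0
  have "{xs. set xs \<subseteq> A \<and> length xs = 0} = {[]}" by auto
  then show ?case
    using assms by (metis card_of_singl_ordLeq finite.emptyI)
next
  case (Suc n)
  let ?L = "{xs. set xs \<subseteq> A \<and> length xs = n}"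
  have "{xs. set xs \<subseteq> A \<and> length xs = Suc n} \<subseteq> (\<lambda>(x, xs). x # xs) ` (A \<times> ?L)"
    by (auto simp: length_Suc_conv image_iff)
  then have "|{xs. set xs \<subseteq> A \<and> length xs = Suc n}| \<le>o |A \<times> ?L|"
    by (rule surj_imp_ordLeq)
  also have "|A \<times> ?L| \<le>o |A|"
    using assms Suc by (intro card_of_Sigma_ordLeq_infinite) (auto intro: card_of_mono1)
  finally show ?case .
qed

lemma card_of_lists_ordLeq:
  assumes "infinite A"
  shows "|lists A| \<le>o |A|"
proof -
  have "lists A = (\<Union>n::nat. {xs. set xs \<subseteq> A \<and> length xs = n})" by auto
  also have "|\<dots>| \<le>o |A|"
    using assms by (intro card_of_UNION_ordLeq_infinite)
      (auto simp: infinite_iff_card_of_nat card_of_lists_length_ordLeq)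
  finally show ?thesis .
qed

lemma card_of_countable_ordLeq:
  assumes "infinite A"
  shows "|UNIV :: 'c::countable set| \<le>o |A|"
proof -
  have "|UNIV :: 'c set| \<le>o |UNIV :: nat set|"
    using card_of_ordLeq[of UNIV UNIV] inj_to_nat by blast
  then show ?thesis
    using assms ordLeq_transitive unfolding infinite_iff_card_of_nat by blast
qed

text \<open>A vector is determined by the finite list of its pairs of index and nonzero value, so
  lists of such pairs cover the set. A key missing from the list stands for the value
  \<open>0\<close>.\<close>

lemma card_of_finite_support_ordLeq:
  assumes "infinite A"
  shows "|{v :: 'j \<Rightarrow> rat. finite {j. v j \<noteq> 0} \<and> {j. v j \<noteq> 0} \<subseteq> A}| \<le>o |A|"
proof -
  let ?V = "{v :: 'j \<Rightarrow> rat. finite {j. v j \<noteq> 0} \<and> {j. v j \<noteq> 0} \<subseteq> A}"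
  let ?f = "\<lambda>xs j. case map_of xs j of None \<Rightarrow> 0 | Some r \<Rightarrow> r"
  have "?V \<subseteq> ?f ` lists (A \<times> (UNIV :: rat set))"
  proof
    fix v assume v: "v \<in> ?V"
    then obtain js where js: "set js = {j. v j \<noteq> 0}"
      using finite_list by blast
    have "v = ?f (map (\<lambda>j. (j, v j)) js)"
      by (auto simp: map_of_map_restrict restrict_map_def js split: option.splits)
    moreover have "map (\<lambda>j. (j, v j)) js \<in> lists (A \<times> UNIV)"
      using v js by auto
    ultimately show "v \<in> ?f ` lists (A \<times> UNIV)" by blast
  qed
  then have "|?V| \<le>o |lists (A \<times> (UNIV :: rat set))|"
    by (rule surj_imp_ordLeq)
  also have "|lists (A \<times> (UNIV :: rat set))| \<le>o |A \<times> (UNIV :: rat set)|"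
    using assms by (intro card_of_lists_ordLeq) (auto simp: finite_cartesian_product_iff)
  also have "|A \<times> (UNIV :: rat set)| \<le>o |A|"
    by (intro card_of_Sigma_ordLeq_infinite assms ballI card_of_countable_ordLeq card_of_mono1) simp
  finally show ?thesis .
qed

subsection \<open>Groups of rational vectors transported to a given type\<close>

text \<open>Roots are mapped to roots. This is applied to inclusions of subgroups and to the
  isomorphisms that witness equality of types.\<close>

lemma p_omega_hom:
  assumes "group G" "group H" "h \<in> hom G H" "x \<in> p_omega p G"
  shows "h x \<in> p_omega p H"
  unfolding p_omega_def multiples_def
proof (rule INT_I)
  fix n :: nat
  obtain g where g: "g \<in> carrier G" "x = g [^]\<^bsub>G\<^esub> (int p ^ n)"
    using assms(4) unfolding p_omega_def multiples_def by blast
  then have "h x = h g [^]\<^bsub>H\<^esub> (int p ^ n)"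
    using hom_int_pow assms by metis
  moreover have "h g \<in> carrier H" using assms(3) g(1) unfolding hom_def by auto
  ultimately show "h x \<in> (\<lambda>g. g [^]\<^bsub>H\<^esub> (int p ^ n)) ` carrier H" by blast
qed

lemma pure_le_id_hom:
  assumes "pure_le M N"
  shows "(\<lambda>x. x) \<in> hom M N"
  using assms subgroup.subset unfolding pure_le_def pure_subgroup_def hom_def by fastforce

definition scaled :: "rat \<Rightarrow> ('j \<Rightarrow> rat) \<Rightarrow> 'j \<Rightarrow> rat" where
  "scaled c v = (\<lambda>j. c * v j)"

lemma scaled_apply: "scaled c v j = c * v j"
  and scaled_zero [simp]: "scaled 0 v = 0" "scaled c 0 = 0"
  and scaled_one [simp]: "scaled 1 v = v"
  and scaled_scaled [simp]: "scaled a (scaled b v) = scaled (a * b) v"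
  and scaled_add: "scaled (a + b) v = scaled a v + scaled b v"
  and scaled_uminus: "scaled (- a) v = - scaled a v"
  by (auto simp: scaled_def fun_eq_iff algebra_simps)

text \<open>The universe \<open>'u\<close> is an arbitrary type, so groups are built from rational
  vectors first and then carried over by an injection.\<close>

locale transport =
  fixes V :: "('j \<Rightarrow> rat) set" and \<phi> :: "('j \<Rightarrow> rat) \<Rightarrow> 'u"
  assumes inj: "inj_on \<phi> V"
begin

text \<open>Arguments are decoded by the inverse of \<phi> on all of \<open>V\<close>, not on
  \<open>W\<close>. All copies thus share literally the same operation, and
  \<open>W \<subseteq> W'\<close> makes one copy a substructure of the other.\<close>

definition copy :: "('j \<Rightarrow> rat) set \<Rightarrow> 'u monoid" where
  "copy W = \<lparr>carrier = \<phi> ` W,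
     monoid.mult = \<lambda>x y. \<phi> (inv_into V \<phi> x + inv_into V \<phi> y), one = \<phi> 0\<rparr>"

definition additive :: "('j \<Rightarrow> rat) set \<Rightarrow> bool" where
  "additive W \<longleftrightarrow> W \<subseteq> V \<and> 0 \<in> W \<and> (\<forall>v\<in>W. \<forall>w\<in>W. v - w \<in> W)"

lemma copy_simps [simp]:
  "carrier (copy W) = \<phi> ` W"
  "\<one>\<^bsub>copy W\<^esub> = \<phi> 0"
  "v \<in> V \<Longrightarrow> w \<in> V \<Longrightarrow> \<phi> v \<otimes>\<^bsub>copy W\<^esub> \<phi> w = \<phi> (v + w)"
  using inj by (simp_all add: copy_def)

lemma copy_mult_eq: "x \<otimes>\<^bsub>copy W\<^esub> y = x \<otimes>\<^bsub>copy W'\<^esub> y"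
  by (simp add: copy_def)

lemma additive_subset: "additive W \<Longrightarrow> v \<in> W \<Longrightarrow> v \<in> V"
  and additive_zero: "additive W \<Longrightarrow> 0 \<in> W"
  and additive_diff: "additive W \<Longrightarrow> v \<in> W \<Longrightarrow> w \<in> W \<Longrightarrow> v - w \<in> W"
  unfolding additive_def by auto

lemma additive_uminus: "additive W \<Longrightarrow> v \<in> W \<Longrightarrow> - v \<in> W"
  using additive_diff[of W 0 v] additive_zero by fastforce

lemma additive_add: "additive W \<Longrightarrow> v \<in> W \<Longrightarrow> w \<in> W \<Longrightarrow> v + w \<in> W"
  using additive_diff[of W v "- w"] additive_uminus by fastforce

lemma additive_scaled_nat: "additive W \<Longrightarrow> v \<in> W \<Longrightarrow> scaled (of_nat n) v \<in> W"
proof (induction n)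
  case 0
  then show ?case using additive_zero by (simp only: of_nat_0 scaled_zero)
next
  case (Suc n)
  have "scaled (of_nat (Suc n)) v = scaled (of_nat n) v + v"
    by (simp add: scaled_add add.commute)
  then show ?case using Suc additive_add by metis
qed

lemma additive_scaled_int: "additive W \<Longrightarrow> v \<in> W \<Longrightarrow> scaled (of_int k) v \<in> W"
proof (cases k)
  case (nonneg n)
  then show "additive W \<Longrightarrow> v \<in> W \<Longrightarrow> ?thesis" using additive_scaled_nat by fastforce
next
  case (neg n)
  have "scaled (of_int k) v = - scaled (of_nat (Suc n)) v"
    unfolding neg of_int_minus scaled_uminus by simp
  then show "additive W \<Longrightarrow> v \<in> W \<Longrightarrow> ?thesis"
    using additive_scaled_nat additive_uminus by metis
qed

lemma comm_group_copy:
  assumes "additive W"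
  shows "comm_group (copy W)"
proof (rule comm_groupI)
  note [simp] = additive_subset[OF assms] additive_add[OF assms]
  show "x \<otimes>\<^bsub>copy W\<^esub> y \<in> carrier (copy W)"
    if "x \<in> carrier (copy W)" "y \<in> carrier (copy W)" for x y
    using that by auto
  show "\<one>\<^bsub>copy W\<^esub> \<in> carrier (copy W)" using additive_zero[OF assms] by simp
  show "x \<otimes>\<^bsub>copy W\<^esub> y \<otimes>\<^bsub>copy W\<^esub> z = x \<otimes>\<^bsub>copy W\<^esub> (y \<otimes>\<^bsub>copy W\<^esub> z)"
    if "x \<in> carrier (copy W)" "y \<in> carrier (copy W)" "z \<in> carrier (copy W)" for x y z
    using that by (auto simp: add.assoc)
  show "x \<otimes>\<^bsub>copy W\<^esub> y = y \<otimes>\<^bsub>copy W\<^esub> x"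
    if "x \<in> carrier (copy W)" "y \<in> carrier (copy W)" for x y
    using that by (auto simp: add.commute)
  show "\<one>\<^bsub>copy W\<^esub> \<otimes>\<^bsub>copy W\<^esub> x = x" if "x \<in> carrier (copy W)" for x
    using that additive_zero[OF assms] by auto
  show "\<exists>y\<in>carrier (copy W). y \<otimes>\<^bsub>copy W\<^esub> x = \<one>\<^bsub>copy W\<^esub>" if "x \<in> carrier (copy W)" for x
  proof -
    from that obtain v where v: "v \<in> W" "x = \<phi> v" by auto
    then have "\<phi> (- v) \<otimes>\<^bsub>copy W\<^esub> x = \<one>\<^bsub>copy W\<^esub>"
      using additive_uminus[OF assms] by simp
    moreover have "\<phi> (- v) \<in> carrier (copy W)"
      using v additive_uminus[OF assms] by simp
    ultimately show ?thesis by blast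
  qed
qed

lemma group_copy: "additive W \<Longrightarrow> group (copy W)"
  using comm_group_copy comm_group.axioms(2) by blast

lemma copy_nat_pow:
  assumes "additive W" "v \<in> W"
  shows "\<phi> v [^]\<^bsub>copy W\<^esub> (n::nat) = \<phi> (scaled (of_nat n) v)"
proof (induction n)
  case 0
  then show ?case by (simp only: of_nat_0 scaled_zero nat_pow_0 copy_simps)
next
  case (Suc n)
  have "scaled (of_nat n) v + v = scaled (of_nat (Suc n)) v"
    by (simp add: scaled_add add.commute)
  then show ?case
    using Suc assms additive_subset additive_scaled_nat by simp
qed

lemma copy_int_pow:
  assumes "additive W" "v \<in> W"
  shows "\<phi> v [^]\<^bsub>copy W\<^esub> (k::int) = \<phi> (scaled (of_int k) v)"
proof (cases k)
  case (nonneg n)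
  then show ?thesis using copy_nat_pow[OF assms] by (simp add: int_pow_int)
next
  case (neg n)
  interpret group "copy W" by (rule group_copy[OF assms(1)])
  define w where "w = scaled (of_nat (Suc n)) v"
  have w: "w \<in> W" unfolding w_def using assms by (rule additive_scaled_nat)
  have k: "scaled (of_int k) v = - w"
    unfolding neg w_def of_int_minus scaled_uminus by simp
  have "- w \<in> W" using assms(1) w by (rule additive_uminus)
  then have "inv\<^bsub>copy W\<^esub> (\<phi> w) = \<phi> (- w)"
    using w additive_subset[OF assms(1)] by (intro inv_equality) auto
  moreover have "\<phi> v \<in> carrier (copy W)" using assms by simp
  ultimately show ?thesis
    unfolding k unfolding neg
    by (simp only: int_pow_neg int_pow_int copy_nat_pow[OF assms] w_def)
qed

lemma torsion_free_copy:
  assumes "additive W"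
  shows "torsion_free (copy W)"
  unfolding torsion_free_def
proof (intro ballI allI impI)
  fix g and n :: nat
  assume "g \<in> carrier (copy W)" "n > 0" and 1: "g [^]\<^bsub>copy W\<^esub> n = \<one>\<^bsub>copy W\<^esub>"
  then obtain v where v: "v \<in> W" "g = \<phi> v" by auto
  then have "scaled (of_nat n) v = 0"
    using 1 assms inj additive_scaled_nat additive_zero additive_subset
    by (metis copy_nat_pow copy_simps(2) inj_onD)
  then have "v = 0" using \<open>n > 0\<close> by (simp add: scaled_def fun_eq_iff)
  with v show "g = \<one>\<^bsub>copy W\<^esub>" by simp
qed

text \<open>Division by \<open>p ^ n\<close> is unique among rational vectors, so the only possible
  root of \<open>\<phi> v\<close> is the copy of the rescaled vector, and divisibility becomes
  membership of all these quotients in \<open>W\<close>.\<close>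

lemma p_omega_copy:
  assumes "additive W" "p > 0"
  shows "p_omega p (copy W) = \<phi> ` {v \<in> W. \<forall>n. scaled (1 / of_nat p ^ n) v \<in> W}"
proof (intro subset_antisym subsetI)
  fix x assume x: "x \<in> p_omega p (copy W)"
  have *: "\<exists>w\<in>W. x = \<phi> (scaled (of_nat p ^ n) w)" for n
  proof -
    obtain w where "w \<in> W" "x = \<phi> w [^]\<^bsub>copy W\<^esub> (int p ^ n)"
      using x unfolding p_omega_def multiples_def by auto
    then show ?thesis using copy_int_pow[OF assms(1)] by auto
  qed
  obtain v where v: "v \<in> W" "x = \<phi> v" using *[of 0] by auto
  have "scaled (1 / of_nat p ^ n) v \<in> W" for n
  proof -
    obtain w where w: "w \<in> W" "x = \<phi> (scaled (of_nat p ^ n) w)" using * by blast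
    have "scaled (of_nat p ^ n) w \<in> W"
      using additive_scaled_nat[OF assms(1) w(1), of "p ^ n"] by simp
    then have "v = scaled (of_nat p ^ n) w"
      using v w inj additive_subset[OF assms(1)] by (metis inj_onD)
    then have "scaled (1 / of_nat p ^ n) v = w" using assms(2) by simp
    with w show ?thesis by simp
  qed
  with v show "x \<in> \<phi> ` {v \<in> W. \<forall>n. scaled (1 / of_nat p ^ n) v \<in> W}" by blast
next
  fix x assume "x \<in> \<phi> ` {v \<in> W. \<forall>n. scaled (1 / of_nat p ^ n) v \<in> W}"
  then obtain v where v: "x = \<phi> v" "\<And>n. scaled (1 / of_nat p ^ n) v \<in> W" by blast
  show "x \<in> p_omega p (copy W)"
    unfolding p_omega_def multiples_def
  proof (rule INT_I)
    fix n :: nat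
    have "x = \<phi> (scaled (1 / of_nat p ^ n) v) [^]\<^bsub>copy W\<^esub> (int p ^ n)"
      using assms(2) v(1) by (simp add: copy_int_pow[OF assms(1) v(2)])
    then show "x \<in> (\<lambda>g. g [^]\<^bsub>copy W\<^esub> (int p ^ n)) ` carrier (copy W)"
      using v(2) by auto
  qed
qed

lemma phi_mem_p_omega_copy:
  assumes "additive W" "p > 0" "v \<in> W"
  shows "\<phi> v \<in> p_omega p (copy W) \<longleftrightarrow> (\<forall>n. scaled (1 / of_nat p ^ n) v \<in> W)"
  using assms inj additive_subset[OF assms(1)] unfolding p_omega_copy[OF assms(1,2)]
  by (auto dest!: inj_onD)

text \<open>The assumption \<open>pure\<close> closes \<open>W\<close> under roots in
  \<open>W'\<close>. Since roots for nonzero \<open>k\<close> are unique, the root found in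
  \<open>W'\<close> is the one that purity asks for.\<close>

lemma pure_le_copy:
  assumes "additive W" "additive W'" "W \<subseteq> W'"
    and pure: "\<And>k v. k \<noteq> 0 \<Longrightarrow> v \<in> W' \<Longrightarrow> scaled (of_int k) v \<in> W \<Longrightarrow> v \<in> W"
  shows "pure_le (copy W) (copy W')"
  unfolding pure_le_def pure_subgroup_def
proof (intro conjI allI ballI)
  interpret N: group "copy W'" by (rule group_copy[OF assms(2)])
  show "subgroup (carrier (copy W)) (copy W')"
  proof (rule N.subgroupI)
    show "carrier (copy W) \<subseteq> carrier (copy W')" using assms(3) by auto
    show "carrier (copy W) \<noteq> {}" using additive_zero[OF assms(1)] by auto
    fix a assume "a \<in> carrier (copy W)"
    then obtain v where v: "v \<in> W" "a = \<phi> v" by auto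
    have "- v \<in> W" using additive_uminus assms(1) v by blast
    then have "inv\<^bsub>copy W'\<^esub> a = \<phi> (- v)"
      using v assms(3) additive_subset[OF assms(1)] by (intro N.inv_equality) auto
    then show "inv\<^bsub>copy W'\<^esub> a \<in> carrier (copy W)" using \<open>- v \<in> W\<close> by simp
    fix b assume "b \<in> carrier (copy W)"
    then show "a \<otimes>\<^bsub>copy W'\<^esub> b \<in> carrier (copy W)"
      using v additive_subset[OF assms(1)] additive_add[OF assms(1)] by auto
  qed
  show "\<one>\<^bsub>copy W\<^esub> = \<one>\<^bsub>copy W'\<^esub>" by simp
  show "x \<otimes>\<^bsub>copy W\<^esub> y = x \<otimes>\<^bsub>copy W'\<^esub> y" for x y by (rule copy_mult_eq)
  fix k :: int
  show "multiples k (copy W') (carrier (copy W)) =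
    carrier (copy W) \<inter> multiples k (copy W') (carrier (copy W'))"
  proof (intro subset_antisym subsetI)
    fix x assume "x \<in> multiples k (copy W') (carrier (copy W))"
    then obtain v where "v \<in> W" "x = \<phi> v [^]\<^bsub>copy W'\<^esub> k" unfolding multiples_def by auto
    then show "x \<in> carrier (copy W) \<inter> multiples k (copy W') (carrier (copy W'))"
      using assms(3) copy_int_pow[OF assms(2)] additive_scaled_int[OF assms(1)]
      unfolding multiples_def by auto
  next
    fix x assume "x \<in> carrier (copy W) \<inter> multiples k (copy W') (carrier (copy W'))"
    then obtain w v where w: "w \<in> W" "x = \<phi> w" and v: "v \<in> W'" "x = \<phi> v [^]\<^bsub>copy W'\<^esub> k"
      unfolding multiples_def by auto
    then have "\<phi> w = \<phi> (scaled (of_int k) v)" using copy_int_pow[OF assms(2)] by simp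
    then have eq: "w = scaled (of_int k) v"
      using inj w v additive_subset[OF assms(1)] additive_subset[OF assms(2)]
        additive_scaled_int[OF assms(2)] by (metis inj_onD)
    show "x \<in> multiples k (copy W') (carrier (copy W))"
    proof (cases "k = 0")
      \<comment> \<open>Here \<open>v\<close> need not lie in \<open>W\<close>, but the power is the
        identity, so \<open>0\<close> serves as a root.\<close>
      case True
      then have "x = \<phi> 0 [^]\<^bsub>copy W'\<^esub> k" using v(2) by simp
      then show ?thesis using additive_zero[OF assms(1)] unfolding multiples_def by auto
    next
      case False
      then have "v \<in> W" using pure v(1) w(1) eq by blast
      with v(2) show ?thesis unfolding multiples_def by auto
    qed
  qed
qed

end

lemma clear_denominators:
  fixes v :: "'j \<Rightarrow> rat"
  assumes "finite {j. v j \<noteq> 0}"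
  obtains d :: nat where "d > 0" "\<And>j. of_nat d * v j \<in> \<int>"
proof -
  have one: "\<exists>d::nat. d > 0 \<and> of_nat d * x \<in> \<int>" for x :: rat
  proof -
    obtain a b where ab: "quotient_of x = (a, b)" by force
    then have "b > 0" "x = of_int a / of_int b"
      using quotient_of_denom_pos quotient_of_div by blast+
    then have "of_nat (nat b) * x = of_int a" by simp
    then show ?thesis using \<open>b > 0\<close> by (metis Ints_of_int zero_less_nat_eq)
  qed
  have "\<exists>d::nat. d > 0 \<and> (\<forall>j\<in>F. of_nat d * v j \<in> \<int>)" if "finite F" for F
    using that
  proof (induction F)
    case empty
    then show ?case by auto
  next
    case (insert j F)
    then obtain d where d: "d > 0" "\<forall>j\<in>F. of_nat d * v j \<in> \<int>" by auto
    obtain e where e: "e > 0" "of_nat e * v j \<in> \<int>" using one by blast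
    have "of_nat e * (of_nat d * v i) \<in> \<int>" if "i \<in> F" for i
      using d that by auto
    moreover have "of_nat d * (of_nat e * v j) \<in> \<int>" using e by auto
    ultimately have "\<forall>i\<in>insert j F. of_nat (e * d) * v i \<in> \<int>"
      by (auto simp: ac_simps)
    then show ?case using d(1) e(1) by (intro exI[of _ "e * d"]) auto
  qed
  from this[OF assms] obtain d :: nat
    where "d > 0" "\<forall>j\<in>{j. v j \<noteq> 0}. of_nat d * v j \<in> \<int>" by blast
  then show ?thesis by (intro that[of d]) force+
qed

subsection \<open>The summands of rank two\<close>

locale three_primes =
  fixes p1 p3 p4 :: nat
  assumes primes: "prime p1" "prime p3" "prime p4"
    and distinct: "p1 \<noteq> p3" "p1 \<noteq> p4" "p3 \<noteq> p4"
begin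

lemma primes_gt: "p1 > 1" "p3 > 1" "p4 > 1" "p1 > 0" "p3 > 0" "p4 > 0"
  using primes[THEN prime_gt_1_nat] primes[THEN prime_gt_0_nat] by auto

lemma coprimes:
  "coprime p1 p3" "coprime p1 p4" "coprime p3 p4" "coprime p3 p1" "coprime p4 p1" "coprime p4 p3"
  using primes distinct primes_coprime by (auto simp: eq_commute)

text \<open>The vector \<open>x e + y z\<close> lies in \<open>\<int>[1/p1] e + \<int>[1/p3] z + \<int>[1/p4] (q e + z)\<close>.\<close>

definition block :: "rat \<Rightarrow> rat \<Rightarrow> rat \<Rightarrow> bool" where
  "block q x y \<longleftrightarrow> (\<exists>a\<in>localization p1. \<exists>b\<in>localization p3. \<exists>c\<in>localization p4.
     x = a + q * c \<and> y = b + c)"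

lemma blockI:
  "a \<in> localization p1 \<Longrightarrow> b \<in> localization p3 \<Longrightarrow> c \<in> localization p4
    \<Longrightarrow> block q (a + q * c) (b + c)"
  unfolding block_def by blast

lemma block_base: "x \<in> localization p1 \<Longrightarrow> block q x 0"
  and block_third: "y \<in> localization p3 \<Longrightarrow> block q 0 y"
  and block_fourth: "y \<in> localization p4 \<Longrightarrow> block q (q * y) y"
  using blockI[of x 0 0 q] blockI[of 0 y 0 q] blockI[of 0 0 y q] by simp_all

lemma block_diff:
  assumes "block q x y" "block q x' y'"
  shows "block q (x - x') (y - y')"
proof -
  obtain a b c where 1: "a \<in> localization p1" "b \<in> localization p3" "c \<in> localization p4"
    "x = a + q * c" "y = b + c" using assms(1) unfolding block_def by blast
  obtain a' b' c' where 2: "a' \<in> localization p1" "b' \<in> localization p3" "c' \<in> localization p4"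
    "x' = a' + q * c'" "y' = b' + c'" using assms(2) unfolding block_def by blast
  have "block q (a - a' + q * (c - c')) (b - b' + (c - c'))"
    using 1 2 by (intro blockI localization_diff)
  then show ?thesis using 1 2 by (simp add: algebra_simps)
qed

section \<open>The weights \<open>1\<close> and \<open>p1\<close>, and the divisible parts of one
  summand\<close>

context
  fixes q :: rat
  assumes q: "q = 1 \<or> q = of_nat p1"
begin

lemma q_Ints: "q \<in> \<int>" and q_nonzero: "q \<noteq> 0"
  using q primes_gt by auto

text \<open>Both weights are units of \<int>[1/p1], although \<open>p1\<close> is not a unit of
  \<int>. The first fact keeps the three lines of a summand apart for either weight; the second lets
  types tell the weights apart.\<close>

lemma localization_q_mult_iff: "q * x \<in> localization p1 \<longleftrightarrow> x \<in> localization p1"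
proof
  assume h: "q * x \<in> localization p1"
  show "x \<in> localization p1"
  proof (cases "q = 1")
    case False
    then have "x = q * x / of_nat p1 ^ 1" using q q_nonzero by auto
    then show ?thesis using localization_divide_power[OF h] primes_gt by metis
  qed (use h in simp)
qed (simp add: localization_mult_Ints q_Ints)

text \<open>The base line gains nothing from the other two: \<open>c = - b\<close> lies in both
  \<int>[1/p3] and \<int>[1/p4], hence in \<int>, and so \<open>q * c\<close> is integral. This is
  the source of purity of \<open>M\<close> in \<open>N\<^sub>S\<close>.\<close>

lemma block_zero_right_iff: "block q x 0 \<longleftrightarrow> x \<in> localization p1"
proof
  assume "block q x 0"
  then obtain a b c where abc: "a \<in> localization p1" "b \<in> localization p3" "c \<in> localization p4"
    "x = a + q * c" "0 = b + c" unfolding block_def by blast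
  then have "c = - b" by simp
  then have "c \<in> \<int>"
    using abc coprimes primes_gt localization_uminus localization_Int_coprime[of p3 p4] by metis
  then have "q * c \<in> \<int>" using q_Ints by simp
  then show "x \<in> localization p1"
    using abc by (simp add: localization_add Ints_subset_localization)
qed (rule block_base)

text \<open>Now \<open>q * c = - a\<close>, so \<open>c\<close> lies in both \<int>[1/p1] and
  \<int>[1/p4] and is an integer.\<close>

lemma block_zero_left_iff: "block q 0 y \<longleftrightarrow> y \<in> localization p3"
proof
  assume "block q 0 y"
  then obtain a b c where abc: "a \<in> localization p1" "b \<in> localization p3" "c \<in> localization p4"
    "0 = a + q * c" "y = b + c" unfolding block_def by blast
  then have "q * c = - a" by simp
  then have "c \<in> localization p1"
    using abc localization_uminus localization_q_mult_iff by metis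
  then have "c \<in> \<int>"
    using abc coprimes primes_gt localization_Int_coprime[of p1 p4] by metis
  then show "y \<in> localization p3"
    using abc by (simp add: localization_add Ints_subset_localization)
qed (rule block_third)

text \<open>Now \<open>q * b = a\<close>, so \<open>b\<close> lies in both \<int>[1/p1] and
  \<int>[1/p3] and is an integer.\<close>

lemma block_diagonal_iff: "block q (q * y) y \<longleftrightarrow> y \<in> localization p4"
proof
  assume "block q (q * y) y"
  then obtain a b c where abc: "a \<in> localization p1" "b \<in> localization p3" "c \<in> localization p4"
    "q * y = a + q * c" "y = b + c" unfolding block_def by blast
  then have "q * b = a" by (simp add: algebra_simps)
  then have "b \<in> localization p1"
    using abc localization_q_mult_iff by metis
  then have "b \<in> \<int>"
    using abc coprimes primes_gt localization_Int_coprime[of p1 p3] by metis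
  then show "y \<in> localization p4"
    using abc by (simp add: localization_add Ints_subset_localization)
qed (rule block_fourth)

text \<open>The coordinate \<open>y\<close> takes values in \<int>[1/(p3 p4)], where only
  \<open>0\<close> is divisible by all powers of \<open>p1\<close>; what remains is the base line.
  The two analogues below likewise use a linear form that vanishes on their line.\<close>

lemma block_p1_divisible_iff:
  "(\<forall>n. block q (x / of_nat p1 ^ n) (y / of_nat p1 ^ n)) \<longleftrightarrow> x \<in> localization p1 \<and> y = 0"
proof
  assume h: "\<forall>n. block q (x / of_nat p1 ^ n) (y / of_nat p1 ^ n)"
  have "y / of_nat p1 ^ n \<in> localization (p3 * p4)" for n
    using h unfolding block_def
    by (metis localization_add localization_mult_left localization_mult_right)
  then have "y = 0"
    using coprimes primes_gt by (intro localization_divisible_eq_0[of p1 "p3 * p4"]) auto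
  then show "x \<in> localization p1 \<and> y = 0"
    using h[rule_format, of 0] by (simp add: block_zero_right_iff)
next
  assume "x \<in> localization p1 \<and> y = 0"
  then show "\<forall>n. block q (x / of_nat p1 ^ n) (y / of_nat p1 ^ n)"
    using primes_gt by (simp add: block_zero_right_iff localization_divide_power)
qed

lemma block_p3_divisible_iff:
  "(\<forall>n. block q (x / of_nat p3 ^ n) (y / of_nat p3 ^ n)) \<longleftrightarrow> x = 0 \<and> y \<in> localization p3"
proof
  assume h: "\<forall>n. block q (x / of_nat p3 ^ n) (y / of_nat p3 ^ n)"
  have "x / of_nat p3 ^ n \<in> localization (p1 * p4)" for n
    using h q_Ints unfolding block_def
    by (metis localization_add localization_mult_left localization_mult_right localization_mult_Ints)
  then have "x = 0"
    using coprimes primes_gt by (intro localization_divisible_eq_0[of p3 "p1 * p4"]) auto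
  then show "x = 0 \<and> y \<in> localization p3"
    using h[rule_format, of 0] by (simp add: block_zero_left_iff)
next
  assume "x = 0 \<and> y \<in> localization p3"
  then show "\<forall>n. block q (x / of_nat p3 ^ n) (y / of_nat p3 ^ n)"
    using primes_gt by (simp add: block_zero_left_iff localization_divide_power)
qed

lemma block_p4_divisible_iff:
  "(\<forall>n. block q (x / of_nat p4 ^ n) (y / of_nat p4 ^ n)) \<longleftrightarrow> x = q * y \<and> y \<in> localization p4"
proof
  assume h: "\<forall>n. block q (x / of_nat p4 ^ n) (y / of_nat p4 ^ n)"
  \<comment> \<open>The form \<open>x - q * y\<close> cancels the contribution of \<open>c\<close>,
    so it takes values in \<int>[1/(p1 p3)].\<close>
  have "(x - q * y) / of_nat p4 ^ n \<in> localization (p1 * p3)" for n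
  proof -
    obtain a b c where abc: "a \<in> localization p1" "b \<in> localization p3"
      "x / of_nat p4 ^ n = a + q * c" "y / of_nat p4 ^ n = b + c"
      using h unfolding block_def by blast
    have "(x - q * y) / of_nat p4 ^ n = x / of_nat p4 ^ n - q * (y / of_nat p4 ^ n)"
      by (simp add: diff_divide_distrib)
    also have "\<dots> = a - q * b" unfolding abc by (simp add: algebra_simps)
    finally show ?thesis
      using abc q_Ints
      by (simp add: localization_diff localization_mult_left localization_mult_right
          localization_mult_Ints)
  qed
  then have "x - q * y = 0"
    using coprimes primes_gt by (intro localization_divisible_eq_0[of p4 "p1 * p3"]) auto
  then show "x = q * y \<and> y \<in> localization p4"
    using h[rule_format, of 0] by (simp add: block_diagonal_iff)
next
  assume "x = q * y \<and> y \<in> localization p4"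
  then show "\<forall>n. block q (x / of_nat p4 ^ n) (y / of_nat p4 ^ n)"
    using primes_gt block_fourth localization_divide_power
    by (metis times_divide_eq_right)
qed

end

end

subsection \<open>The groups \<open>M\<close> and \<open>N\<^sub>S\<close>\<close>

text \<open>The indices \<open>(i, False)\<close> and \<open>(i, True)\<close> belong to the basis vectors \<open>e\<^sub>i\<close> and \<open>z\<^sub>i\<close>.\<close>

definition finsupp :: "'i set \<Rightarrow> ('i \<times> bool \<Rightarrow> rat) set" where
  "finsupp A = {v. finite {j. v j \<noteq> 0} \<and> {j. v j \<noteq> 0} \<subseteq> A \<times> UNIV}"

lemma finsupp_zero: "0 \<in> finsupp A"
  unfolding finsupp_def by simp

lemma finsupp_diff:
  assumes "v \<in> finsupp A" "w \<in> finsupp A"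
  shows "v - w \<in> finsupp A"
proof -
  have "{j. (v - w) j \<noteq> 0} \<subseteq> {j. v j \<noteq> 0} \<union> {j. w j \<noteq> 0}" by auto
  with assms show ?thesis
    unfolding finsupp_def by (auto intro: finite_subset[OF _ finite_UnI])
qed

lemma finsupp_scaled: "v \<in> finsupp A \<Longrightarrow> scaled c v \<in> finsupp A"
  unfolding finsupp_def by (auto simp: scaled_apply elim!: rev_finite_subset)

lemma card_of_finsupp_ordLeq:
  assumes "infinite A"
  shows "|finsupp A| \<le>o |A|"
proof -
  have "infinite (A \<times> (UNIV :: bool set))"
    using assms by (auto simp: finite_cartesian_product_iff)
  then have "|finsupp A| \<le>o |A \<times> (UNIV :: bool set)|"
    unfolding finsupp_def by (rule card_of_finite_support_ordLeq)
  also have "|A \<times> (UNIV :: bool set)| \<le>o |A|"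
    by (intro card_of_Sigma_ordLeq_infinite assms ballI card_of_countable_ordLeq card_of_mono1) simp
  finally show ?thesis .
qed

definition unit :: "'j \<Rightarrow> 'j \<Rightarrow> rat" where
  "unit j = (\<lambda>k. if k = j then 1 else 0)"

lemma unit_finsupp: "i \<in> A \<Longrightarrow> unit (i, t) \<in> finsupp A"
  unfolding finsupp_def unit_def by auto

text \<open>Serves for vectors built from one coordinate of each pair, possibly moved to the other
  coordinate: the support stays within the same finitely many pairs.\<close>

lemma finsupp_reindex:
  assumes "v \<in> finsupp A" "\<And>i t. w (i, t) \<noteq> 0 \<Longrightarrow> v (i, s) \<noteq> 0"
  shows "w \<in> finsupp A"
proof -
  have sub: "{j. w j \<noteq> 0} \<subseteq> (fst ` {j. v j \<noteq> 0}) \<times> UNIV"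
    using assms(2) by (force simp: image_iff)
  have "finite ((fst ` {j. v j \<noteq> 0}) \<times> (UNIV :: bool set))"
    using assms(1) unfolding finsupp_def by auto
  then show ?thesis
    using assms(1) sub finite_subset[OF sub] unfolding finsupp_def by fastforce
qed

locale construction = three_primes p1 p3 p4 + transport "finsupp A" \<phi>
  for p1 p3 p4 :: nat and A :: "'i set" and \<phi> :: "('i \<times> bool \<Rightarrow> rat) \<Rightarrow> 'u"
begin

definition base :: "('i \<times> bool \<Rightarrow> rat) set" where
  "base = {v \<in> finsupp A. \<forall>i. v (i, False) \<in> localization p1 \<and> v (i, True) = 0}"

text \<open>The coefficients \<open>q\<^sub>i\<close> that code \<open>S\<close>;
  \<open>base\<close> and \<open>ext S\<close> hold the vectors of \<open>M\<close> and
  \<open>N\<^sub>S\<close>.\<close>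

definition weight :: "'i set \<Rightarrow> 'i \<Rightarrow> rat" where
  "weight S i = (if i \<in> S then 1 else of_nat p1)"

definition ext :: "'i set \<Rightarrow> ('i \<times> bool \<Rightarrow> rat) set" where
  "ext S = {v \<in> finsupp A. \<forall>i. block (weight S i) (v (i, False)) (v (i, True))}"

lemma weight: "weight S i = 1 \<or> weight S i = of_nat p1"
  unfolding weight_def by simp

lemmas weight_nonzero = q_nonzero[OF weight]
  and weight_Ints = q_Ints[OF weight]

lemma base_finsupp: "v \<in> base \<Longrightarrow> v \<in> finsupp A"
  and ext_finsupp: "v \<in> ext S \<Longrightarrow> v \<in> finsupp A"
  unfolding base_def ext_def by auto

lemma additive_base: "additive base"
  unfolding additive_def base_def by (auto simp: finsupp_zero finsupp_diff localization_diff)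

lemma additive_ext: "additive (ext S)"
  unfolding additive_def ext_def
  by (auto simp: finsupp_zero finsupp_diff block_diff block_base)

lemma base_subset_ext: "base \<subseteq> ext S"
  unfolding base_def ext_def by (auto simp: block_base)

text \<open>Inside \<open>ext S\<close> the base is cut out by the vanishing of all
  \<open>z\<^sub>i\<close> coordinates, a condition unaffected by nonzero multiples.\<close>

lemma pure_le_base_ext: "pure_le (copy base) (copy (ext S))"
proof (rule pure_le_copy[OF additive_base additive_ext base_subset_ext])
  fix k :: int and v assume "k \<noteq> 0" and v: "v \<in> ext S" "scaled (of_int k) v \<in> base"
  then have "v (i, True) = 0" for i
    unfolding base_def by (auto simp: scaled_apply)
  then show "v \<in> base"
    using v(1) block_zero_right_iff[OF weight] unfolding base_def ext_def by fastforce
qed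

section \<open>The divisible parts of \<open>N\<^sub>S\<close>, computed summand by summand\<close>

lemma ext_divisible_iff:
  assumes "v \<in> ext S"
  shows "(\<forall>n. scaled (1 / of_nat p ^ n) v \<in> ext S) \<longleftrightarrow>
    (\<forall>i n. block (weight S i) (v (i, False) / of_nat p ^ n) (v (i, True) / of_nat p ^ n))"
  using finsupp_scaled[OF ext_finsupp[OF assms]] unfolding ext_def
  by (auto simp: scaled_apply)

lemma ext_p1_omega_iff:
  assumes "v \<in> ext S"
  shows "\<phi> v \<in> p_omega p1 (copy (ext S)) \<longleftrightarrow> v \<in> base"
  unfolding phi_mem_p_omega_copy[OF additive_ext primes_gt(4) assms]
    ext_divisible_iff[OF assms] block_p1_divisible_iff[OF weight]
  using ext_finsupp[OF assms] by (simp add: base_def)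

lemma ext_p3_omega_iff:
  assumes "v \<in> ext S"
  shows "\<phi> v \<in> p_omega p3 (copy (ext S)) \<longleftrightarrow> 
    (\<forall>i. v (i, False) = 0 \<and> v (i, True) \<in> localization p3)"
  unfolding phi_mem_p_omega_copy[OF additive_ext primes_gt(5) assms]
    ext_divisible_iff[OF assms] block_p3_divisible_iff[OF weight]
  ..

lemma ext_p4_omega_iff:
  assumes "v \<in> ext S"
  shows "\<phi> v \<in> p_omega p4 (copy (ext S)) \<longleftrightarrow> 
    (\<forall>i. v (i, False) = weight S i * v (i, True) \<and> v (i, True) \<in> localization p4)"
  unfolding phi_mem_p_omega_copy[OF additive_ext primes_gt(6) assms]
    ext_divisible_iff[OF assms] block_p4_divisible_iff[OF weight]
  ..

lemma p_omega_ext_obtain: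
  assumes "x \<in> p_omega p (copy (ext S))"
  obtains v where "v \<in> ext S" "x = \<phi> v"
proof -
  \<comment> \<open>Exponent \<open>0\<close> of the intersection already gives membership in the
    carrier.\<close>
  have "x \<in> multiples (int p ^ 0) (copy (ext S)) (carrier (copy (ext S)))"
    using assms unfolding p_omega_def by blast
  then show ?thesis
    using that copy_int_pow[OF additive_ext] unfolding multiples_def by auto
qed

section \<open>Membership of \<open>M\<close> and \<open>N\<^sub>S\<close> in the class\<close>

lemma base_in_K1_hat: "copy base \<in> K1_hat p1"
proof -
  have "carrier (copy base) = p_omega p1 (copy base)"
  proof -
    have "scaled (1 / of_nat p1 ^ n) v \<in> base" if "v \<in> base" for v n
      using that primes_gt unfolding base_def
      by (auto simp: finsupp_scaled scaled_apply localization_divide_power)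
    then show ?thesis
      unfolding p_omega_copy[OF additive_base primes_gt(4)] by auto
  qed
  moreover have "p_omega p (copy base) = {\<one>\<^bsub>copy base\<^esub>}" if p: "prime p" "p \<noteq> p1" for p
  proof -
    have "{v \<in> base. \<forall>n. scaled (1 / of_nat p ^ n) v \<in> base} = {0}"
    proof (intro subset_antisym subsetI)
      fix v assume v: "v \<in> {v \<in> base. \<forall>n. scaled (1 / of_nat p ^ n) v \<in> base}"
      have "v (i, False) = 0" for i
        using v p primes(1) primes_gt prime_gt_1_nat[OF p(1)] unfolding base_def
        by (intro localization_divisible_eq_0[of p p1]) (auto simp: primes_coprime scaled_apply)
      moreover have "v (i, True) = 0" for i using v unfolding base_def by auto
      ultimately have "v (i, t) = 0" for i t by (cases t) auto
      then show "v \<in> {0}" by (auto simp: fun_eq_iff)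
    qed (use additive_zero[OF additive_base] in auto)
    then show ?thesis
      using p by (subst p_omega_copy[OF additive_base]) (auto simp: prime_gt_0_nat)
  qed
  ultimately show ?thesis
    unfolding K1_hat_def using comm_group_copy torsion_free_copy additive_base by blast
qed

text \<open>A \<open>p4\<close>-divisible sum lies on the diagonals, so \<open>g\<close> determines
  \<open>z\<close>, which is (a). For (b) the coordinates of \<open>z\<close> must be those of
  \<open>g\<close> times \<open>k / q\<^sub>i\<close>, and \<open>k\<close> is chosen to make them
  integral.\<close>

lemma ext_in_K2_hat: "copy (ext S) \<in> K2_hat p1 p3 p4"
  unfolding K2_hat_def mem_Collect_eq
proof (intro conjI ballI impI)
  show "comm_group (copy (ext S))" "torsion_free (copy (ext S))"
    using comm_group_copy torsion_free_copy additive_ext by blast+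
next
  fix g z z' assume g: "g \<in> p_omega p1 (copy (ext S))" and z: "z \<in> p_omega p3 (copy (ext S))"
    and z': "z' \<in> p_omega p3 (copy (ext S))"
    and sum: "g \<otimes>\<^bsub>copy (ext S)\<^esub> z \<in> p_omega p4 (copy (ext S)) \<and>
      g \<otimes>\<^bsub>copy (ext S)\<^esub> z' \<in> p_omega p4 (copy (ext S))"
  obtain u v w where uvw: "u \<in> ext S" "v \<in> ext S" "w \<in> ext S" "g = \<phi> u" "z = \<phi> v" "z' = \<phi> w"
    using g z z' p_omega_ext_obtain by metis
  have "u + v \<in> ext S" "u + w \<in> ext S" using uvw additive_add[OF additive_ext] by auto
  with sum uvw have diag:
    "(u + v) (i, False) = weight S i * (u + v) (i, True)"
    "(u + w) (i, False) = weight S i * (u + w) (i, True)" for i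
    using ext_p4_omega_iff ext_finsupp by (metis copy_simps(3))+
  have zeros: "u (i, True) = 0" "v (i, False) = 0" "w (i, False) = 0" for i
    using uvw g z z' ext_p1_omega_iff ext_p3_omega_iff unfolding base_def by auto
  have "v (i, t) = w (i, t)" for i t
  proof -
    have "weight S i * v (i, True) = weight S i * w (i, True)"
      using diag[of i] zeros[of i] by simp
    then have "v (i, True) = w (i, True)" using weight_nonzero by simp
    then show ?thesis using zeros[of i] by (cases t) simp_all
  qed
  then have "v = w" by auto
  then show "z = z'" using uvw by simp
next
  fix g assume g: "g \<in> p_omega p1 (copy (ext S))"
  then obtain v where v: "v \<in> ext S" "g = \<phi> v" using p_omega_ext_obtain by blast
  then have "v \<in> base" using g ext_p1_omega_iff by blast
  obtain d :: nat where d: "d > 0" "\<And>j. of_nat d * v j \<in> \<int>"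
    using clear_denominators v(1) ext_finsupp unfolding finsupp_def by blast
  \<comment> \<open>The factor \<open>d\<close> clears the denominators of \<open>v\<close>, and
    \<open>p1\<close> absorbs the division by a weight \<open>p1\<close> in
    \<open>w\<close>.\<close>
  define k where "k = int (d * p1)"
  define w where "w = (\<lambda>(i, t). if t then of_nat (d * p1) * v (i, False) / weight S i else 0 :: rat)"
  \<comment> \<open>Integrality serves twice, since \<int> lies in both rings: for
    \<open>p3\<close>-divisibility of \<open>w\<close> and for \<open>p4\<close>-divisibility of the
    sum.\<close>
  have w_Ints: "w (i, True) \<in> \<int>" for i
  proof -
    have "of_nat p1 * (of_nat d * v (i, False)) \<in> \<int>" using d by auto
    moreover have "w (i, True) = of_nat d * v (i, False) \<or>
        w (i, True) = of_nat p1 * (of_nat d * v (i, False))"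
      using primes_gt by (simp add: w_def weight_def)
    ultimately show ?thesis using d(2) by metis
  qed
  have "w \<in> finsupp A"
    using ext_finsupp[OF v(1)] by (rule finsupp_reindex[where s = False]) (auto simp: w_def split: if_splits)
  then have w: "w \<in> ext S"
    using w_Ints unfolding ext_def
    by (auto simp: block_zero_left_iff[OF weight] Ints_subset_localization w_def)
  then have "\<phi> w \<in> p_omega p3 (copy (ext S))"
    using w_Ints unfolding ext_p3_omega_iff[OF w]
    by (auto simp: Ints_subset_localization w_def)
  moreover have kv: "scaled (of_int k) v \<in> ext S"
    using additive_scaled_int[OF additive_ext v(1)] .
  then have sum: "scaled (of_int k) v + w \<in> ext S"
    using additive_add[OF additive_ext _ w] by blast
  have "v (i, True) = 0" for i using \<open>v \<in> base\<close> unfolding base_def by auto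
  then have "\<phi> (scaled (of_int k) v + w) \<in> p_omega p4 (copy (ext S))"
    using w_Ints weight_nonzero unfolding ext_p4_omega_iff[OF sum]
    by (auto simp: scaled_apply k_def w_def Ints_subset_localization)
  then have "g [^]\<^bsub>copy (ext S)\<^esub> k \<otimes>\<^bsub>copy (ext S)\<^esub> \<phi> w \<in> p_omega p4 (copy (ext S))"
    unfolding v(2) copy_int_pow[OF additive_ext v(1)]
    using kv w ext_finsupp by simp
  moreover have "k > 0" using d(1) primes_gt by (simp add: k_def)
  ultimately show "\<exists>k::int. k > 0 \<and> (\<exists>z\<in>p_omega p3 (copy (ext S)).
      g [^]\<^bsub>copy (ext S)\<^esub> k \<otimes>\<^bsub>copy (ext S)\<^esub> z \<in> p_omega p4 (copy (ext S)))"
    by blast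
qed

subsection \<open>Closures and types\<close>

lemma unit_True_in_ext: "i \<in> A \<Longrightarrow> unit (i, True) \<in> ext S"
  unfolding ext_def using unit_finsupp
  by (auto simp: unit_def block_zero_left_iff[OF weight])

lemma unit_False_in_base: "i \<in> A \<Longrightarrow> unit (i, False) \<in> base"
  unfolding base_def using unit_finsupp by (auto simp: unit_def)

text \<open>The element \<open>z\<close> of index \<open>i0\<close> forces \<open>M\<close> into
  \<open>K2_hat\<close>. Condition (b), applied to elements of the base, then produces multiples of
  the \<open>z\<close> part of any \<open>v\<close> inside \<open>M\<close>, and purity divides them
  again.\<close>

lemma ext_subset_closed:
  assumes i0: "i0 \<in> A" and M: "M \<in> K_hat p1 p3 p4" and le: "pure_le M (copy (ext S))"
    and sub: "insert (\<phi> (unit (i0, True))) (\<phi> ` base) \<subseteq> carrier M"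
    and v: "v \<in> ext S"
  shows "\<phi> v \<in> carrier M"
proof -
  let ?N = "copy (ext S)"
  have M_group: "group M"
    using M comm_group.axioms(2) unfolding K_hat_def K1_hat_def K2_hat_def by blast
  have N_group: "group ?N" by (rule group_copy[OF additive_ext])
  note id_hom = pure_le_id_hom[OF le]
  have omega: "x \<in> p_omega p ?N" if "x \<in> p_omega p M" for p x
    using p_omega_hom[OF M_group N_group id_hom that] .
  have mult: "x \<otimes>\<^bsub>M\<^esub> y = x \<otimes>\<^bsub>?N\<^esub> y" if "x \<in> carrier M" "y \<in> carrier M" for x y
    using le that unfolding pure_le_def by blast
  have pow: "x [^]\<^bsub>M\<^esub> k = x [^]\<^bsub>?N\<^esub> k" if "x \<in> carrier M" for x and k :: int
    using hom_int_pow[OF id_hom that M_group N_group] .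
  \<comment> \<open>In a group of \<open>K1_hat\<close> every element is
    \<open>p1\<close>-divisible, but a \<open>z\<^sub>i\<close> is not even so in the larger group
    \<open>N\<^sub>S\<close>.\<close>
  have "M \<notin> K1_hat p1"
  proof
    assume "M \<in> K1_hat p1"
    then have "\<phi> (unit (i0, True)) \<in> p_omega p1 ?N"
      using sub omega unfolding K1_hat_def by auto
    then have "unit (i0, True) \<in> base"
      using ext_p1_omega_iff unit_True_in_ext[OF i0] by blast
    then have "unit (i0, True) (i0, True) = 0" unfolding base_def by blast
    then show False by (simp add: unit_def)
  qed
  then have K2: "M \<in> K2_hat p1 p3 p4" using M unfolding K_hat_def by blast
  obtain d :: nat where d: "d > 0" "\<And>j. of_nat d * v j \<in> \<int>"
    using clear_denominators ext_finsupp[OF v] unfolding finsupp_def by blast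
  \<comment> \<open>The weights are put into \<open>g\<close> so that the diagonal equations for
    \<open>k g + z\<close> can only be solved by the \<open>z\<close> part of \<open>k d v\<close>.
    The factor \<open>d\<close> makes \<open>g\<close> integral, hence a base vector.\<close>
  define g where "g = (\<lambda>(i, t). if t then 0 else weight S i * (of_nat d * v (i, True)))"
  have "g \<in> finsupp A"
    using ext_finsupp[OF v] by (rule finsupp_reindex[where s = True]) (auto simp: g_def split: if_splits)
  moreover have "weight S i * (of_nat d * v (i, True)) \<in> \<int>" for i
    using d(2) weight_Ints by (rule Ints_mult[rotated])
  ultimately have g: "g \<in> base"
    unfolding base_def by (auto simp: g_def Ints_subset_localization)
  \<comment> \<open>Condition (b) for \<open>M\<close> needs \<open>p1\<close>-divisibility inside
    \<open>M\<close>. The roots of \<open>\<phi> g\<close> exist already in the base, which is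
    included in \<open>M\<close>.\<close>
  have "(\<lambda>x. x) \<in> hom (copy base) M"
    unfolding hom_def mem_Collect_eq
  proof (intro conjI ballI)
    show "(\<lambda>x. x) \<in> carrier (copy base) \<rightarrow> carrier M" using sub by auto
    fix x y assume "x \<in> carrier (copy base)" "y \<in> carrier (copy base)"
    then have "x \<in> carrier M" "y \<in> carrier M" using sub by auto
    then show "x \<otimes>\<^bsub>copy base\<^esub> y = x \<otimes>\<^bsub>M\<^esub> y"
      using copy_mult_eq mult by metis
  qed
  moreover have "\<phi> g \<in> p_omega p1 (copy base)"
    using base_in_K1_hat g unfolding K1_hat_def by auto
  ultimately have "\<phi> g \<in> p_omega p1 M"
    using p_omega_hom[OF group_copy[OF additive_base] M_group] by fast
  then obtain k :: int and z where k: "k > 0" and z: "z \<in> p_omega p3 M"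
    and sum: "\<phi> g [^]\<^bsub>M\<^esub> k \<otimes>\<^bsub>M\<^esub> z \<in> p_omega p4 M"
    using K2 unfolding K2_hat_def by blast
  have z_carrier: "z \<in> carrier M"
  proof -
    obtain y where "y \<in> carrier M" "z = y [^]\<^bsub>M\<^esub> (int p3 ^ 0)"
      using z unfolding p_omega_def multiples_def by blast
    then show ?thesis using group.int_pow_closed[OF M_group] by simp
  qed
  have g_carrier: "\<phi> g \<in> carrier M" using sub g by auto
  have g_ext: "g \<in> ext S" using g base_subset_ext by blast
  obtain w where w: "w \<in> ext S" "z = \<phi> w" using omega[OF z] p_omega_ext_obtain by blast
  have kg: "scaled (of_int k) g \<in> ext S" using additive_scaled_int[OF additive_ext g_ext] .
  have gw: "scaled (of_int k) g + w \<in> ext S" using additive_add[OF additive_ext kg w(1)] .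
  have pow_g: "\<phi> g [^]\<^bsub>M\<^esub> k = \<phi> (scaled (of_int k) g)"
    using pow[OF g_carrier] copy_int_pow[OF additive_ext g_ext] by simp
  then have "\<phi> (scaled (of_int k) g) \<in> carrier M"
    using group.int_pow_closed[OF M_group g_carrier] by metis
  then have "\<phi> (scaled (of_int k) g + w) = \<phi> g [^]\<^bsub>M\<^esub> k \<otimes>\<^bsub>M\<^esub> z"
    using z_carrier kg w ext_finsupp unfolding pow_g by (subst mult) auto
  with omega[OF sum] have "\<phi> (scaled (of_int k) g + w) \<in> p_omega p4 ?N" by simp
  then have diag: "of_int k * g (i, False) + w (i, False) =
      weight S i * (of_int k * g (i, True) + w (i, True))" for i
    unfolding ext_p4_omega_iff[OF gw] by (simp add: scaled_apply)
  have w_False: "w (i, False) = 0" for i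
    using omega[OF z] ext_p3_omega_iff[OF w(1)] w(2) by blast
  then have w_True: "w (i, True) = of_int (k * int d) * v (i, True)" for i
    using diag[of i] weight_nonzero[of S i] by (simp add: g_def)
  \<comment> \<open>This is the \<open>e\<close> part of \<open>k d v\<close>. It is integral and so
    lies in the base, while \<open>w\<close> is the \<open>z\<close> part.\<close>
  define h where "h = (\<lambda>(i, t). if t then 0 else of_int (k * int d) * v (i, False))"
  have "h \<in> finsupp A"
    using ext_finsupp[OF v] by (rule finsupp_reindex[where s = False]) (auto simp: h_def split: if_splits)
  moreover have "of_int k * (of_nat d * v (i, False)) \<in> \<int>" for i
    by (rule Ints_mult[OF Ints_of_int d(2)])
  ultimately have h: "h \<in> base"
    unfolding base_def by (auto simp: h_def Ints_subset_localization mult.assoc)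
  have hw: "scaled (of_int (k * int d)) v = h + w"
  proof
    fix j :: "'i \<times> bool"
    obtain i t where "j = (i, t)" by force
    then show "scaled (of_int (k * int d)) v j = (h + w) j"
      by (cases t) (simp_all add: scaled_apply h_def w_False w_True)
  qed
  \<comment> \<open>Both parts are in \<open>M\<close>, so the positive multiple \<open>k d\<close>
    of \<open>v\<close> is in \<open>M\<close>.\<close>
  have "\<phi> v [^]\<^bsub>?N\<^esub> (k * int d) = \<phi> h \<otimes>\<^bsub>M\<^esub> \<phi> w"
    using sub h z_carrier w base_finsupp ext_finsupp
    by (subst mult) (auto simp: copy_int_pow[OF additive_ext v] hw simp del: of_int_mult)
  moreover have "\<phi> h \<otimes>\<^bsub>M\<^esub> \<phi> w \<in> carrier M"
    using sub h z_carrier w(2) M_group by (auto intro: group.is_monoid monoid.m_closed)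
  moreover have "\<phi> v [^]\<^bsub>?N\<^esub> (k * int d) \<in> multiples (k * int d) ?N (carrier ?N)"
    using v unfolding multiples_def copy_simps(1) by (intro imageI)
  ultimately have "\<phi> v [^]\<^bsub>?N\<^esub> (k * int d) \<in>
      carrier M \<inter> multiples (k * int d) ?N (carrier ?N)"
    by simp
  \<comment> \<open>Purity yields a root in \<open>M\<close>, and uniqueness of division identifies
    it with \<open>\<phi> v\<close>.\<close>
  then have "\<phi> v [^]\<^bsub>?N\<^esub> (k * int d) \<in> multiples (k * int d) ?N (carrier M)"
    using le unfolding pure_le_def pure_subgroup_def by simp
  then obtain x where x: "x \<in> carrier M" "\<phi> v [^]\<^bsub>?N\<^esub> (k * int d) = x [^]\<^bsub>?N\<^esub> (k * int d)"
    unfolding multiples_def by blast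
  have "carrier M \<subseteq> carrier ?N" using id_hom unfolding hom_def by auto
  then obtain u where u: "u \<in> ext S" "x = \<phi> u" using x(1) by auto
  have "\<phi> (scaled (of_int (k * int d)) v) = \<phi> (scaled (of_int (k * int d)) u)"
    using x(2) unfolding u(2) copy_int_pow[OF additive_ext v] copy_int_pow[OF additive_ext u(1)] .
  then have "scaled (of_int (k * int d)) v = scaled (of_int (k * int d)) u"
    using inj_onD[OF inj] additive_scaled_int[OF additive_ext] v u(1) ext_finsupp by meson
  then have "v = u" using k d(1) by (auto simp: fun_eq_iff scaled_apply)
  with x(1) u(2) show ?thesis by simp
qed

text \<open>The whole group is one of the intersected subgroups, and each of the others contains it
  by the preceding lemma.\<close>

lemma cl_ext:
  assumes "i0 \<in> A"
  shows "cl p1 p3 p4 (copy (ext S)) (insert (\<phi> (unit (i0, True))) (\<phi> ` base)) = \<phi> ` ext S"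
proof
  have "pure_le (copy (ext S)) (copy (ext S))"
    by (rule pure_le_copy[OF additive_ext additive_ext])
      (auto simp: ext_def block_def finsupp_def scaled_apply)
  moreover have "insert (\<phi> (unit (i0, True))) (\<phi> ` base) \<subseteq> carrier (copy (ext S))"
    using unit_True_in_ext[OF assms] base_subset_ext by auto
  moreover have "copy (ext S) \<in> K_hat p1 p3 p4"
    using ext_in_K2_hat unfolding K_hat_def by blast
  ultimately have "carrier (copy (ext S)) \<in> {carrier M |M.
      insert (\<phi> (unit (i0, True))) (\<phi> ` base) \<subseteq> carrier M \<and> pure_le M (copy (ext S)) \<and>
      M \<in> K_hat p1 p3 p4}" by blast
  then show "cl p1 p3 p4 (copy (ext S)) (insert (\<phi> (unit (i0, True))) (\<phi> ` base)) \<subseteq> \<phi> ` ext S"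
    unfolding cl_def by (metis (no_types, lifting) Inter_lower copy_simps(1))
  show "\<phi> ` ext S \<subseteq> cl p1 p3 p4 (copy (ext S)) (insert (\<phi> (unit (i0, True))) (\<phi> ` base))"
    unfolding cl_def using ext_subset_closed[OF assms] by blast
qed

text \<open>Equality of the types in question thus becomes an isomorphism between entire groups
  \<open>N\<^sub>S\<close> that fixes the base.\<close>

lemma cl_group_ext:
  assumes "i0 \<in> A"
  shows "cl_group p1 p3 p4 (copy (ext S)) (insert (\<phi> (unit (i0, True))) (\<phi> ` base)) = copy (ext S)"
  unfolding cl_group_def cl_ext[OF assms] by (simp add: copy_def)

text \<open>For \<open>i \<in> S\<close> the image \<open>w\<close> of \<open>z\<^sub>i\<close> is
  \<open>p3\<close>-divisible and \<open>e\<^sub>i + w\<close> is \<open>p4\<close>-divisible in the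
  second group. The weight of \<open>i\<close> there then has an integral inverse, so it is
  \<open>1\<close> and not \<open>p1\<close>.\<close>

lemma gtp_eq_imp_subset:
  assumes "i0 \<in> A" "S \<subseteq> A"
    and eq: "gtp_eq p1 p3 p4 (\<phi> ` base)
      (\<phi> (unit (i0, True)), copy (ext S)) (\<phi> (unit (i0, True)), copy (ext T))"
  shows "S \<subseteq> T"
proof
  fix i assume "i \<in> S"
  then have "i \<in> A" using assms(2) by blast
  obtain f where f: "f \<in> iso (copy (ext S)) (copy (ext T))" and fixed: "\<And>a. a \<in> \<phi> ` base \<Longrightarrow> f a = a"
    using eq unfolding gtp_eq_def by (auto simp: cl_group_ext[OF assms(1)])
  then have f_hom: "f \<in> hom (copy (ext S)) (copy (ext T))" unfolding iso_def by blast
  note omega = p_omega_hom[OF group_copy[OF additive_ext] group_copy[OF additive_ext] f_hom]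
  let ?e = "unit (i, False)" and ?z = "unit (i, True)"
  have z: "?z \<in> ext S" using \<open>i \<in> A\<close> by (rule unit_True_in_ext)
  have e: "?e \<in> base" using \<open>i \<in> A\<close> by (rule unit_False_in_base)
  then have e_ext: "?e \<in> ext R" for R using base_subset_ext by blast
  have ez: "?e + ?z \<in> ext S" using additive_add[OF additive_ext e_ext z] .
  have "\<phi> ?z \<in> p_omega p3 (copy (ext S))"
    unfolding ext_p3_omega_iff[OF z] by (simp add: unit_def)
  from omega[OF this] obtain w where w: "w \<in> ext T" "f (\<phi> ?z) = \<phi> w"
    and w_omega: "\<phi> w \<in> p_omega p3 (copy (ext T))"
    using p_omega_ext_obtain by metis
  have ew: "?e + w \<in> ext T" using additive_add[OF additive_ext e_ext w(1)] .
  have "\<phi> (?e + ?z) \<in> p_omega p4 (copy (ext S))"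
    unfolding ext_p4_omega_iff[OF ez] using \<open>i \<in> S\<close> by (simp add: unit_def weight_def)
  \<comment> \<open>The vector \<open>?e\<close> belongs to the base and is therefore fixed.\<close>
  moreover have "f (\<phi> (?e + ?z)) = \<phi> (?e + w)"
  proof -
    have "f (\<phi> ?e \<otimes>\<^bsub>copy (ext S)\<^esub> \<phi> ?z) = f (\<phi> ?e) \<otimes>\<^bsub>copy (ext T)\<^esub> f (\<phi> ?z)"
      using f_hom e_ext z unfolding hom_def by auto
    then show ?thesis
      using e z w fixed base_finsupp ext_finsupp by simp
  qed
  ultimately have "\<phi> (?e + w) \<in> p_omega p4 (copy (ext T))" using omega by metis
  then have "(?e + w) (i, False) = weight T i * (?e + w) (i, True)"
    and 4: "(?e + w) (i, True) \<in> localization p4"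
    unfolding ext_p4_omega_iff[OF ew] by blast+
  moreover have "w (i, False) = 0" and 3: "w (i, True) \<in> localization p3"
    using w_omega unfolding ext_p3_omega_iff[OF w(1)] by blast+
  ultimately have 1: "weight T i * w (i, True) = 1" by (simp add: unit_def)
  have "w (i, True) \<in> localization p4" using 4 by (simp add: unit_def)
  \<comment> \<open>Being in \<int>[1/p3] and in \<int>[1/p4] makes the coordinate an integer; only
    here does \<open>p1\<close> stop being invertible.\<close>
  with 3 have "w (i, True) \<in> \<int>"
    using localization_Int_coprime[of p3 p4] coprimes primes_gt by blast
  then obtain m where m: "w (i, True) = of_int m" by (auto elim: Ints_cases)
  show "i \<in> T"
  proof (rule ccontr)
    assume "i \<notin> T"
    then have "of_int (int p1 * m) = (1 :: rat)" using 1 m by (simp add: weight_def)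
    then have "int p1 * m = 1" by (simp only: of_int_eq_1_iff)
    then have "int p1 = 1" using zmult_eq_1_iff by fastforce
    then show False using primes_gt by simp
  qed
qed

lemma gtp_ext_inj:
  assumes "i0 \<in> A"
  shows "inj_on (\<lambda>S. gtp p1 p3 p4 (\<phi> (unit (i0, True))) (\<phi> ` base) (copy (ext S))) (Pow A)"
proof (rule inj_onI)
  let ?b = "\<phi> (unit (i0, True))"
  fix S T assume ST: "S \<in> Pow A" "T \<in> Pow A"
    and eq: "gtp p1 p3 p4 ?b (\<phi> ` base) (copy (ext S)) = gtp p1 p3 p4 ?b (\<phi> ` base) (copy (ext T))"
  \<comment> \<open>Each pair lies in its own type, so equality of the two classes gives
    \<open>gtp_eq\<close> in both directions, hence both inclusions, without symmetry of
    \<open>gtp_eq\<close>.\<close>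
  have self: "(?b, copy (ext R)) \<in> gtp p1 p3 p4 ?b (\<phi> ` base) (copy (ext R))" for R
  proof -
    have "gtp_eq p1 p3 p4 (\<phi> ` base) (?b, copy (ext R)) (?b, copy (ext R))"
      unfolding gtp_eq_def prod.case
      by (intro bexI[of _ "\<lambda>x. x"]) (auto intro: iso_set_refl)
    moreover have "copy (ext R) \<in> K_hat p1 p3 p4"
      using ext_in_K2_hat unfolding K_hat_def by blast
    moreover have "\<phi> ` base \<subseteq> \<phi> ` ext R" using base_subset_ext by blast
    ultimately show ?thesis
      using unit_True_in_ext[OF assms] unfolding gtp_def by simp
  qed
  have "gtp_eq p1 p3 p4 (\<phi> ` base) (?b, copy (ext S)) (?b, copy (ext T))"
    "gtp_eq p1 p3 p4 (\<phi> ` base) (?b, copy (ext T)) (?b, copy (ext S))"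
    using self[of S] self[of T] eq unfolding gtp_def by blast+
  then show "S = T" using gtp_eq_imp_subset[OF assms] ST by blast
qed

section \<open>Counting types over \<open>M\<close> and elements of \<open>M\<close>\<close>

lemma card_of_Pow_ordLeq_gS:
  assumes "A \<noteq> {}"
  shows "|Pow A| \<le>o |gS p1 p3 p4 (copy base)|"
proof -
  from assms obtain i0 where i0: "i0 \<in> A" by blast
  let ?g = "\<lambda>S. gtp p1 p3 p4 (\<phi> (unit (i0, True))) (\<phi> ` base) (copy (ext S))"
  have "?g S \<in> gS p1 p3 p4 (copy base)" for S
  proof -
    have "\<phi> (unit (i0, True)) \<in> carrier (copy (ext S))"
      using unit_True_in_ext[OF i0] by simp
    moreover have "copy (ext S) \<in> K_hat p1 p3 p4"
      using ext_in_K2_hat unfolding K_hat_def by blast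
    ultimately show ?thesis
      unfolding gS_def copy_simps(1)
      by (intro CollectI exI conjI) (rule refl, rule pure_le_base_ext, auto)
  qed
  then have "?g ` Pow A \<subseteq> gS p1 p3 p4 (copy base)" by blast
  with gtp_ext_inj[OF i0] have "\<exists>f. inj_on f (Pow A) \<and> f ` Pow A \<subseteq> gS p1 p3 p4 (copy base)"
    by (intro exI conjI)
  then show ?thesis unfolding card_of_ordLeq .
qed

text \<open>The upper bound counts all finitely supported vectors, the lower bound the basis vectors
  \<open>e\<^sub>i\<close>.\<close>

lemma card_of_base:
  assumes "infinite A"
  shows "|carrier (copy base)| =o |A|"
proof (rule ordIso_iff_ordLeq[THEN iffD2, OF conjI])
  have "|carrier (copy base)| \<le>o |finsupp A|"
    unfolding copy_simps(1)
    by (rule ordLeq_transitive[OF card_of_image card_of_mono1]) (use base_finsupp in blast)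
  also have "|finsupp A| \<le>o |A|" using assms by (rule card_of_finsupp_ordLeq)
  finally show "|carrier (copy base)| \<le>o |A|" .
  have "inj_on (\<lambda>i. \<phi> (unit (i, False))) A"
  proof (rule inj_onI)
    fix i j assume "i \<in> A" "j \<in> A" "\<phi> (unit (i, False)) = \<phi> (unit (j, False))"
    then have "unit (i, False) = unit (j, False)"
      using inj_onD[OF inj] unit_finsupp by metis
    then have "unit (i, False) (i, False) = unit (j, False) (i, False)" by simp
    then show "i = j" by (simp add: unit_def split: if_splits)
  qed
  moreover have "(\<lambda>i. \<phi> (unit (i, False))) ` A \<subseteq> carrier (copy base)"
    using unit_False_in_base by auto
  ultimately have "\<exists>f. inj_on f A \<and> f ` A \<subseteq> carrier (copy base)"
    by (intro exI conjI)
  then show "|A| \<le>o |carrier (copy base)|" unfolding card_of_ordLeq .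
qed

end

section \<open>Instability at an arbitrary infinite cardinal\<close>

theorem theorem3p14:
  fixes p1 p3 p4 :: nat and \<kappa> :: "'b rel"
  assumes "prime p1" and "prime p3" and "prime p4"
    and "p1 \<noteq> p3" and "p1 \<noteq> p4" and "p3 \<noteq> p4"
    and "Cinfinite \<kappa>"
    and "\<kappa> \<le>o |UNIV :: 'u set|"
  shows "\<not> stable_in p1 p3 p4 TYPE('u) \<kappa> \<and>
    (\<exists>M :: 'u monoid. M \<in> K_hat p1 p3 p4 \<and> |carrier M| =o \<kappa> \<and> \<kappa> <o |gS p1 p3 p4 M| )"
proof -
  have inf: "infinite (Field \<kappa>)" and field: "|Field \<kappa>| =o \<kappa>"
    using assms(7) card_of_Field_ordIso unfolding cinfinite_def by blast+
  \<comment> \<open>With \<open>Field \<kappa>\<close> as index set there are at most \<kappa>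
    vectors, so they fit into \<open>'u\<close>; this supplies the injection for the
    construction.\<close>
  have "|finsupp (Field \<kappa>)| \<le>o |Field \<kappa>|" using inf by (rule card_of_finsupp_ordLeq)
  also have "|Field \<kappa>| \<le>o |UNIV :: 'u set|"
    using field assms(8) by (rule ordIso_ordLeq_trans)
  finally have "\<exists>\<phi> :: ('b \<times> bool \<Rightarrow> rat) \<Rightarrow> 'u. inj_on \<phi> (finsupp (Field \<kappa>)) \<and>
      \<phi> ` finsupp (Field \<kappa>) \<subseteq> UNIV"
    unfolding card_of_ordLeq .
  then obtain \<phi> :: "('b \<times> bool \<Rightarrow> rat) \<Rightarrow> 'u" where inj: "inj_on \<phi> (finsupp (Field \<kappa>))"
    by (elim exE conjE)
  interpret construction p1 p3 p4 "Field \<kappa>" \<phi>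
    by unfold_locales (fact assms inj)+
  let ?M = "copy base"
  have M: "?M \<in> K_hat p1 p3 p4" using base_in_K1_hat unfolding K_hat_def by blast
  have card_M: "|carrier ?M| =o \<kappa>"
    using card_of_base[OF inf] field by (rule ordIso_transitive)
  \<comment> \<open>Cantor's theorem: the subsets \<open>S\<close> of the index set already
    outnumber \<kappa>.\<close>
  have "\<kappa> <o |Pow (Field \<kappa>)|"
    using ordIso_symmetric[OF field] card_of_Pow by (rule ordIso_ordLess_trans)
  also have "|Pow (Field \<kappa>)| \<le>o |gS p1 p3 p4 ?M|"
    using inf by (intro card_of_Pow_ordLeq_gS) auto
  finally have "\<kappa> <o |gS p1 p3 p4 ?M|" .
  then have "\<not> stable_in p1 p3 p4 TYPE('u) \<kappa>"
    using M card_M not_ordLess_ordLeq unfolding stable_in_def by blast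
  with M card_M \<open>\<kappa> <o |gS p1 p3 p4 ?M|\<close> show ?thesis by blast
qed

end
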